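(* Let $\xi\in (0,0.5)$ and $\alpha \in (0,1)$. There exists $N$ such that for all integers $n\ge N$, all integers $k$ with $1\le k\leq n^{\alpha}$, and all $r,s\in [n]$ (with $r\ne s$ if $k=1$), there exists $\pi \in \mathrm{Sym}(n,k)$ such that $(r,s,\pi)$ is admissible and \[\left(1-\tfrac1e -\xi\right)\mathrm{c}(n-1,k-\delta_{r,s}) \leq |\mathrm{Sym}(n,k)[(r,s);\pi]| \leq \left(1-\tfrac1e +\xi\right)\mathrm{c}(n-1,k-\delta_{r,s}),\] where $\delta_{r,s}$ is the Kronecker delta.
   Context: $[n]=\{1,\dots,n\}$. $\mathrm{Sym}(n,k)$ is the set of permutations of $[n]$ with exactly $k$ cycles in their cycle decomposition (fixed points count as cycles). $\mathrm{c}(m,l)$ is the unsigned Stirling number of the first kind, i.e. the number of permutations of $[m]$ with exactly $l$ cycles. For $r,s\in[n]$ and $\pi\in\mathrm{Sym}(n,k)$, the triple $(r,s,\pi)$ is called admissible if $\pi(r)\neq s$ and, additionally, $r\neq s$ whenever $k=1$. For an admissible triple, \[\mathrm{Sym}(n,k)[(r,s);\pi]:=\{\tau \in \mathrm{Sym}(n,k):\ \tau(r)=s\ \text{and}\ \tau(i)=\pi(i)\text{ for some } i\in[n]\}.\] *)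

theory Defs
  imports Complex_Main "HOL-Combinatorics.Stirling" "HOL-Combinatorics.Orbits"
begin

text \<open>
  The cycles of a permutation of a set are represented by their underlying sets, i.e. by its
  orbits; since \<^term>\<open>orbit p x\<close> is a singleton for a fixed point \<^term>\<open>x\<close>,
  fixed points count as cycles. Permutations of \<open>[n]\<close> are functions on \<^typ>\<open>nat\<close> that are the
  identity outside \<open>{1..n}\<close>, so each one has exactly one representative.
\<close>

definition cycles_on :: "'a set \<Rightarrow> ('a \<Rightarrow> 'a) \<Rightarrow> 'a set set" where
  "cycles_on S p = orbit p ` S"

definition Sym :: "nat \<Rightarrow> nat \<Rightarrow> (nat \<Rightarrow> nat) set" where
  "Sym n k = {p. p permutes {1..n} \<and> card (cycles_on {1..n} p) = k}"

definition admissible_triple :: "nat \<Rightarrow> nat \<Rightarrow> nat \<Rightarrow> nat \<Rightarrow> (nat \<Rightarrow> nat) \<Rightarrow> bool" where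
  "admissible_triple n k r s \<pi> \<longleftrightarrow>
     r \<in> {1..n} \<and> s \<in> {1..n} \<and> \<pi> \<in> Sym n k \<and> \<pi> r \<noteq> s \<and> (k = 1 \<longrightarrow> r \<noteq> s)"

definition Sym_meeting ::
    "nat \<Rightarrow> nat \<Rightarrow> nat \<Rightarrow> nat \<Rightarrow> (nat \<Rightarrow> nat) \<Rightarrow> (nat \<Rightarrow> nat) set" where
  "Sym_meeting n k r s \<pi> = {\<tau> \<in> Sym n k. \<tau> r = s \<and> (\<exists>i\<in>{1..n}. \<tau> i = \<pi> i)}"

text \<open>
  The library defines \<^const>\<open>stirling\<close> by its recurrence. The remaining facts show that it
  counts permutations by their number of cycles; the recurrence comes from inserting a new
  point \<open>a\<close> into a cycle, directly before \<open>b\<close>.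
\<close>

lemma orbit_transpose_comp:
  assumes p: "p permutes S" and a: "a \<notin> S" and b: "b \<in> S" and y: "y \<in> S"
  shows "orbit (transpose a b \<circ> p) y =
         (if b \<in> orbit p y then insert a (orbit p y) else orbit p y)" (is "orbit ?q y = ?R")
proof -
  have sub: "orbit p y \<subseteq> S" using p y by (rule permutes_orbit_subset)
  have pa: "p a = a" using p a by (simp add: permutes_not_in)
  have ne: "p z \<noteq> a" if "z \<in> S" for z using p a that by (metis permutes_in_image)
  have qa: "?q a = b" by (simp add: pa)
  have qz: "?q z = (if p z = b then a else p z)" if "z \<in> S" for z
    using ne[OF that] by (auto simp: transpose_def)
  have 1: "z \<in> ?R" if "z \<in> orbit ?q y" for z
    using that
  proof induction
    case base
    have "p y \<in> orbit p y" by (rule orbit.base)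
    then show ?case unfolding qz[OF y] by auto
  next
    case (step z)
    show ?case
    proof (cases "z = a")
      case True
      with step.IH a sub have "b \<in> orbit p y" by (auto split: if_splits)
      then show ?thesis using True qa by simp
    next
      case False
      with step.IH have z: "z \<in> orbit p y" by (auto split: if_splits)
      then have "p z \<in> orbit p y" by (rule orbit.step)
      moreover have "z \<in> S" using z sub by auto
      ultimately show ?thesis by (subst qz) auto
    qed
  qed
  have reach: "p w \<in> orbit ?q y \<and> (p w = b \<longrightarrow> a \<in> orbit ?q y)"
    if w: "w \<in> S" "?q w \<in> orbit ?q y" for w
    using w(2) orbit.step[of a ?q y] unfolding qa qz[OF w(1)] by (auto split: if_splits)
  have from_p: "z \<in> orbit ?q y \<and> (z = b \<longrightarrow> a \<in> orbit ?q y)" if "z \<in> orbit p y" for z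
    using that
  proof induction
    case base
    show ?case by (rule reach[OF y orbit.base])
  next
    case (step z)
    then show ?case using sub by (intro reach orbit.step) auto
  qed
  show ?thesis
  proof (intro subset_antisym subsetI)
    show "z \<in> ?R" if "z \<in> orbit ?q y" for z using 1[OF that] .
    show "z \<in> orbit ?q y" if "z \<in> ?R" for z
      using that from_p[of z] from_p[of b] by (cases "b \<in> orbit p y") auto
  qed
qed

lemma card_cycles_on_transpose_comp:
  assumes "finite S" and p: "p permutes S" and a: "a \<notin> S" and b: "b \<in> insert a S"
  shows "card (cycles_on (insert a S) (transpose a b \<circ> p)) =
         (if b = a then Suc (card (cycles_on S p)) else card (cycles_on S p))"
proof (cases "b = a")
  case True
  have "p a = a" using p a by (simp add: permutes_not_in)
  then have "orbit p a = {a}" by (simp add: orbit_eq_singleton_iff)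
  moreover have "{a} \<notin> orbit p ` S"
    using permutes_orbit_subset[OF p] a by blast
  ultimately show ?thesis
    using True \<open>finite S\<close> by (simp add: cycles_on_def)
next
  case False
  with b have b: "b \<in> S" by simp
  let ?q = "transpose a b \<circ> p"
  let ?f = "\<lambda>C. if b \<in> C then insert a C else C"
  have "?q permutes insert a S"
    using p b by (intro permutes_compose[OF permutes_subset[OF p]] permutes_swap_id) auto
  then have "permutation ?q" using \<open>finite S\<close> by (auto simp: permutation_permutes)
  moreover have "?q a = b" using p a by (simp add: permutes_not_in)
  ultimately have "orbit ?q a = orbit ?q b" using permutation_orbit_step by metis
  then have "cycles_on (insert a S) ?q = orbit ?q ` S" using b by (auto simp: cycles_on_def)
  also have "\<dots> = ?f ` cycles_on S p"
    unfolding cycles_on_def image_image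
    by (rule image_cong[OF refl]) (rule orbit_transpose_comp[OF p a b])
  finally have "cycles_on (insert a S) ?q = ?f ` cycles_on S p" .
  moreover have "inj_on ?f (cycles_on S p)"
  proof (rule inj_onI)
    fix C D assume CD: "C \<in> cycles_on S p" "D \<in> cycles_on S p" "?f C = ?f D"
    then have "a \<notin> C" "a \<notin> D"
      using permutes_orbit_subset[OF p] a by (auto simp: cycles_on_def)
    with CD(3) show "C = D" by (auto split: if_splits)
  qed
  ultimately show ?thesis using False by (simp only: card_image if_False)
qed

lemma card_permutes_cycles_on:
  assumes "finite S"
  shows "card {p. p permutes S \<and> card (cycles_on S p) = k} = stirling (card S) k"
  using assms
proof (induction S arbitrary: k rule: finite_induct)
  case empty
  have "{p. p permutes {} \<and> card (cycles_on {} p) = k} = (if k = 0 then {id} else {})"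
    by (auto simp: cycles_on_def)
  then show ?case by (cases k) auto
next
  case (insert a S)
  let ?A = "\<lambda>S k. {p. p permutes S \<and> card (cycles_on S p) = k}"
  let ?g = "\<lambda>(b, p). transpose a b \<circ> p"
  have fin: "finite (?A S k)" for k
    using finite_permutations[OF insert(1)] by (rule finite_subset[rotated]) auto
  show ?case
  proof (cases k)
    case 0
    have "?A (insert a S) 0 = {}" using insert(1) by (auto simp: cycles_on_def)
    then show ?thesis using 0 insert(1,2) by (simp only: card.empty) simp
  next
    case (Suc l)
    let ?P = "{a} \<times> ?A S l \<union> S \<times> ?A S k"
    have "?A (insert a S) k = ?g ` ?P"
    proof (intro set_eqI iffI)
      fix q assume "q \<in> ?A (insert a S) k"
      then have q: "q permutes insert a S" "card (cycles_on (insert a S) q) = k" by auto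
      then obtain b p where bp: "b \<in> insert a S" "p permutes S" "q = transpose a b \<circ> p"
        using permutes_insert[of a S] by (auto simp: set_eq_iff image_iff)
      then have "(b, p) \<in> ?P"
        using card_cycles_on_transpose_comp[OF insert(1) bp(2) insert(2) bp(1)] q(2) Suc
        by (auto split: if_splits)
      then show "q \<in> ?g ` ?P" using bp(3) by force
    next
      fix q assume "q \<in> ?g ` ?P"
      then obtain b p where bp: "(b, p) \<in> ?P" "q = transpose a b \<circ> p" by auto
      then have *: "b \<in> insert a S" "p permutes S" by auto
      then have "q permutes insert a S"
        using permutes_insert[of a S] bp(2) by (auto simp: set_eq_iff image_iff)
      then show "q \<in> ?A (insert a S) k"
        using card_cycles_on_transpose_comp[OF insert(1) *(2) insert(2) *(1)] bp Suc insert(2)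
        by auto
    qed
    moreover have "inj_on ?g ?P"
    proof (rule inj_onI)
      fix x y assume xy: "x \<in> ?P" "y \<in> ?P" "?g x = ?g y"
      obtain b p c q where [simp]: "x = (b, p)" "y = (c, q)" by fastforce
      have mem: "(b, p) \<in> ?P" "(c, q) \<in> ?P"
        and eq: "transpose a b \<circ> p = transpose a c \<circ> q"
        using xy by auto
      have "p a = a" "q a = a" using mem insert(2) by (auto simp: permutes_not_in)
      with fun_cong[OF eq, of a] have "b = c" by simp
      moreover have "transpose a b \<circ> (transpose a b \<circ> p) = transpose a b \<circ> (transpose a b \<circ> q)"
        using eq \<open>b = c\<close> by simp
      ultimately show "x = y" by (simp add: o_assoc)
    qed
    ultimately have "card (?A (insert a S) k) = card ?P" by (simp only: card_image)
    also have "\<dots> = card ({a} \<times> ?A S l) + card (S \<times> ?A S k)"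
      using insert(1,2) fin by (intro card_Un_disjoint) auto
    also have "\<dots> = stirling (card (insert a S)) k"
      using insert Suc by (simp add: card_cartesian_product)
    finally show ?thesis .
  qed
qed

lemma card_Sym: "card (Sym n k) = stirling n k"
  using card_permutes_cycles_on[of "{1..n}" k] by (simp add: Sym_def)

end

(*
  Choose a permutation pi all of whose cycles are long, with pi (pi r) = s when r and s differ.
  Prescribing tau r = s together with tau i = pi i for boundedly many i then closes no cycle other
  than the fixed point r = s, so contracting the prescribed edges shows that the number of such tau
  is exactly a Stirling number c(n - 1 - j, l), which depends only on the number j of prescribed
  agreements. The j-th binomial moment of the number of agreements is therefore
  (n - 2 choose j) c(n - 1 - j, l); relative to c(n - 1, l) it is 1/j! up to O(k/n), because a
  permutation with l cycles has at most l fixed points. The Bonferroni inequalities conclude.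
*)
theory Submission
  imports Defs "HOL-Real_Asymp.Real_Asymp"
begin

section \<open>Counting permutations with prescribed edges\<close>

text \<open>
  The rank \<open>h\<close> says that the prescribed edges \<open>x \<mapsto> f x\<close> form no cycle. It survives contracting an
  edge, which makes the induction go through.
\<close>

lemma card_permutes_extending:
  fixes f :: "'a \<Rightarrow> 'a" and h :: "'a \<Rightarrow> nat"
  assumes "finite S" "D \<subseteq> S" "f ` D \<subseteq> S" "inj_on f D"
    and "\<And>x. x \<in> D \<Longrightarrow> h (f x) < h x"
  shows "card {p. p permutes S \<and> card (cycles_on S p) = k \<and> (\<forall>x\<in>D. p x = f x)}
    = stirling (card S - card D) k"
proof -
  have "finite D" using assms(1,2) by (rule finite_subset[rotated])
  then show ?thesis using assms
  proof (induction D arbitrary: S f rule: finite_induct)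
    case empty
    then show ?case using card_permutes_cycles_on[of S k] by simp
  next
    case (insert i D)
    let ?t = "f i" and ?S = "S - {i}"
    \<comment> \<open>Contracting the edge from \<open>i\<close> to \<open>f i\<close> deletes
      \<open>i\<close> and sends a predecessor of \<open>i\<close> straight to \<open>f i\<close>.
      On \<open>D\<close> this is \<open>?g\<close>, since injectivity of \<open>f\<close> keeps
      every other edge away from \<open>f i\<close>.\<close>
    let ?g = "transpose i ?t \<circ> f"
    let ?A = "{p. p permutes S \<and> card (cycles_on S p) = k \<and> (\<forall>x\<in>insert i D. p x = f x)}"
    let ?B = "{q. q permutes ?S \<and> card (cycles_on ?S q) = k \<and> (\<forall>x\<in>D. q x = ?g x)}"
    have S: "insert i ?S = S" "finite ?S" "i \<notin> ?S" using insert.prems by auto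
    have t: "?t \<noteq> i" "?t \<in> S" using insert.prems(5)[of i] insert.prems(3) by auto
    have fD: "f x \<noteq> ?t" if "x \<in> D" for x
      using insert.prems(4) insert.hyps(2) that by (auto simp: inj_on_def)
    have gx: "?g x = (if f x = i then ?t else f x)" if "x \<in> D" for x
      using fD[OF that] by (auto simp: transpose_def)
    have IH: "card ?B = stirling (card ?S - card D) k"
    proof (rule insert.IH)
      show "D \<subseteq> ?S" using insert.prems(2) insert.hyps(2) by auto
      show "?g ` D \<subseteq> ?S"
      proof
        fix y assume "y \<in> ?g ` D"
        then obtain x where x: "x \<in> D" "y = ?g x" by blast
        then show "y \<in> ?S" using gx[OF x(1)] insert.prems(3) t by auto
      qed
      show "inj_on ?g D"
        using insert.prems(4) by (intro comp_inj_on) (auto intro: inj_on_subset[OF inj_transpose])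
      \<comment> \<open>When \<open>f x = i\<close>, the contracted edge combines two edges, and
        \<open>h\<close> drops along both.\<close>
      show "h (?g x) < h x" if "x \<in> D" for x
        using gx[OF that] insert.prems(5)[of x] insert.prems(5)[of i] that by auto
    qed (use S in auto)
    \<comment> \<open>Since \<open>h (f i) < h i\<close>, the point \<open>f i\<close> differs from
      \<open>i\<close>: putting \<open>i\<close> back enlarges an existing cycle and never opens a
      new one, so \<open>k\<close> is preserved.\<close>
    have cyc: "card (cycles_on S (transpose i ?t \<circ> q)) = card (cycles_on ?S q)"
      if "q permutes ?S" for q
      using card_cycles_on_transpose_comp[OF S(2) that S(3), of ?t] S(1) t by simp
    have "?A = (\<lambda>q. transpose i ?t \<circ> q) ` ?B"
    proof (intro set_eqI iffI)
      fix p assume "p \<in> ?A"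
      then have p: "p permutes S" "card (cycles_on S p) = k" "p i = ?t" "\<And>x. x \<in> D \<Longrightarrow> p x = f x"
        by auto
      let ?q = "transpose i ?t \<circ> p"
      have q: "?q permutes ?S"
        using permutes_insert_lemma[of p i ?S] p S by simp
      have pq: "p = transpose i ?t \<circ> ?q" by (simp add: o_assoc)
      have "card (cycles_on ?S ?q) = k" using cyc[OF q] p(2) unfolding pq[symmetric] by simp
      moreover have "\<forall>x\<in>D. ?q x = ?g x" using p(4) by simp
      ultimately show "p \<in> (\<lambda>q. transpose i ?t \<circ> q) ` ?B" using q pq by blast
    next
      fix p assume "p \<in> (\<lambda>q. transpose i ?t \<circ> q) ` ?B"
      then obtain q where q: "q permutes ?S" "card (cycles_on ?S q) = k" "\<And>x. x \<in> D \<Longrightarrow> q x = ?g x"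
        and p: "p = transpose i ?t \<circ> q" by auto
      have "p permutes S" unfolding p
        using t insert.prems(2) q(1)
        by (intro permutes_compose[OF permutes_subset[OF q(1)]] permutes_swap_id) auto
      moreover have "q i = i" using q(1) by (auto simp: permutes_not_in)
      moreover have "p x = f x" if "x \<in> D" for x using q(3)[OF that] by (simp add: p)
      ultimately show "p \<in> ?A" using cyc[OF q(1)] q(2) p by auto
    qed
    moreover have "inj_on (\<lambda>q. transpose i ?t \<circ> q) ?B"
      by (rule inj_on_inverseI[where g = "\<lambda>q. transpose i ?t \<circ> q"]) (simp add: o_assoc)
    ultimately have "card ?A = card ?B" by (simp add: card_image)
    then show ?case using IH insert.hyps insert.prems(1,2) S
      by (simp add: card_Diff_singleton)
  qed
qed

text \<open>The rank of \<open>x\<close> is the number of steps after which its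
  \<open>f\<close>-path leaves \<open>D\<close>. By the pigeonhole principle, a path that stayed in
  \<open>D\<close> would repeat within \<open>card D\<close> steps, so only periods up to
  \<open>card D\<close> have to be excluded.\<close>

lemma exists_rank_function:
  fixes f :: "'a \<Rightarrow> 'a"
  assumes "finite D" and "\<And>x a. x \<in> D \<Longrightarrow> 1 \<le> a \<Longrightarrow> a \<le> card D \<Longrightarrow> (f ^^ a) x \<noteq> x"
  shows "\<exists>h :: 'a \<Rightarrow> nat. \<forall>x\<in>D. h (f x) < h x"
proof (intro exI ballI)
  let ?h = "\<lambda>x. LEAST m. (f ^^ m) x \<notin> D"
  fix x assume x: "x \<in> D"
  have "\<exists>m. (f ^^ m) x \<notin> D"
  proof (rule ccontr)
    assume "\<not> ?thesis"
    then have *: "(f ^^ m) x \<in> D" for m by blast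
    have "\<not> inj_on (\<lambda>m. (f ^^ m) x) {..card D}"
    proof
      assume "inj_on (\<lambda>m. (f ^^ m) x) {..card D}"
      then have "card {..card D} \<le> card D"
        using * assms(1) by (intro card_inj_on_le) auto
      then show False by simp
    qed
    then obtain u v where uv: "u < v" "v \<le> card D" "(f ^^ u) x = (f ^^ v) x"
      unfolding inj_on_def by (metis atMost_iff linorder_neqE_nat)
    have "(f ^^ (v - u)) ((f ^^ u) x) = (f ^^ u) x"
      using uv by (metis comp_apply funpow_add le_add_diff_inverse2 less_imp_le)
    moreover have "1 \<le> v - u" "v - u \<le> card D" using uv by auto
    ultimately show False using assms(2)[OF *[of u]] by blast
  qed
  then obtain m where "(f ^^ m) x \<notin> D" by blast
  then have "?h x = Suc (LEAST m. (f ^^ Suc m) x \<notin> D)"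
    by (rule Least_Suc) (simp add: x)
  then show "?h (f x) < ?h x" by (simp add: funpow_swap1)
qed

section \<open>Permutations with long cycles and a prescribed two-step path\<close>

lemma orbit_transpose_comp_new:
  assumes "finite S" and p: "p permutes S" and a: "a \<notin> S" and b: "b \<in> S"
  shows "orbit (transpose a b \<circ> p) a = insert a (orbit p b)"
proof -
  let ?q = "transpose a b \<circ> p"
  have "?q permutes insert a S"
    using b by (intro permutes_compose[OF permutes_subset[OF p]] permutes_swap_id) auto
  then have perm: "permutation ?q" using \<open>finite S\<close> by (auto simp: permutation_permutes)
  have "?q a = b" using p a by (simp add: permutes_not_in)
  then have "orbit ?q a = orbit ?q b" using permutation_orbit_step[OF perm] by metis
  moreover have "b \<in> orbit p b"
    using p \<open>finite S\<close> permutation_permutes permutation_self_in_orbit by metis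
  ultimately show ?thesis using orbit_transpose_comp[OF p a b b] by simp
qed

text \<open>Inserting \<open>a\<close> before \<open>b\<close> lengthens the cycle of
  \<open>b\<close> by one and leaves the others alone. The witness \<open>z\<close> names the old
  cycle behind that of \<open>y\<close>, so lower bounds on cycle lengths carry over.\<close>

lemma card_orbit_transpose_comp:
  assumes fin: "finite S" and p: "p permutes S" and a: "a \<notin> S" and b: "b \<in> S"
    and y: "y \<in> insert a S"
  shows "\<exists>z\<in>S. card (orbit (transpose a b \<circ> p) y) = card (orbit p z) + of_bool (b \<in> orbit p z) \<and>
    (b \<in> orbit (transpose a b \<circ> p) y \<longleftrightarrow> b \<in> orbit p z)"
proof -
  have sub: "orbit p z \<subseteq> S" if "z \<in> S" for z using p that by (rule permutes_orbit_subset)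
  have card_ins: "card (insert a (orbit p z)) = card (orbit p z) + 1" if "z \<in> S" for z
    using sub[OF that] a finite_subset[OF sub[OF that] fin] by (subst card_insert_disjoint) auto
  have bb: "b \<in> orbit p b"
    using p fin permutation_permutes permutation_self_in_orbit by metis
  show ?thesis
  proof (cases "y = a")
    case True
    then show ?thesis
      using orbit_transpose_comp_new[OF fin p a b] card_ins[OF b] bb b by (intro bexI[of _ b]) auto
  next
    case False
    then have "y \<in> S" using y by simp
    then show ?thesis
      using orbit_transpose_comp[OF p a b, of y] card_ins[of y] by (intro bexI[of _ y]) auto
  qed
qed

text \<open>
  The cycle of \<open>a\<close> is the one still growing: it has length at least \<open>j\<close>, the others at least \<open>L\<close>.
\<close>

lemma exists_permutes_long_cycles_aux:
  assumes "1 \<le> L" "1 \<le> j" "finite S" "card S = k * L + j"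
  shows "\<exists>p a. a \<in> S \<and> p permutes S \<and> card (cycles_on S p) = Suc k \<and>
    (\<forall>x\<in>S. (if a \<in> orbit p x then j else L) \<le> card (orbit p x))"
  using assms
proof (induction "card S" arbitrary: S j k)
  case 0
  then show ?case by simp
next
  case (Suc m)
  obtain b S' where S: "S = insert b S'" "b \<notin> S'" "finite S'"
    using Suc.hyps(2) Suc.prems(3) by (metis card_Suc_eq_finite)
  have m: "m = card S'" using Suc.hyps(2) S by simp
  show ?case
  proof (cases "j = 1")
    case False
    then have j: "1 \<le> j - 1" "card S' = k * L + (j - 1)"
      using Suc.prems Suc.hyps(2) m by auto
    obtain p a where p: "a \<in> S'" "p permutes S'" "card (cycles_on S' p) = Suc k"
      "\<And>x. x \<in> S' \<Longrightarrow> (if a \<in> orbit p x then j - 1 else L) \<le> card (orbit p x)"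
      using Suc.hyps(1)[OF m Suc.prems(1) j(1) S(3) j(2)] by blast
    \<comment> \<open>The new point \<open>b\<close> joins the growing cycle, directly before its
      marked point \<open>a\<close>.\<close>
    let ?q = "transpose b a \<circ> p"
    have "?q permutes S" unfolding S(1)
      using p(1) by (intro permutes_compose[OF permutes_subset[OF p(2)]] permutes_swap_id) auto
    moreover have "card (cycles_on S ?q) = Suc k"
      using card_cycles_on_transpose_comp[OF S(3) p(2) S(2), of a] p(1,3) S by auto
    moreover have "(if a \<in> orbit ?q x then j else L) \<le> card (orbit ?q x)" if "x \<in> S" for x
    proof -
      obtain z where z: "z \<in> S'" "card (orbit ?q x) = card (orbit p z) + of_bool (a \<in> orbit p z)"
        "a \<in> orbit ?q x \<longleftrightarrow> a \<in> orbit p z"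
        using card_orbit_transpose_comp[OF S(3) p(2) S(2) p(1), of x] \<open>x \<in> S\<close>
        unfolding S(1) by blast
      then show ?thesis using p(4)[OF z(1)] by auto
    qed
    ultimately show ?thesis using p(1) S(1) by blast
  next
    case j: True
    show ?thesis
    proof (cases k)
      case 0
      then have "S = {b}" using Suc.prems j S by auto
      moreover have "orbit id b = {b}" by (simp add: orbit_eq_singleton_iff)
      ultimately show ?thesis using 0 j
        by (intro exI[of _ id] exI[of _ b]) (simp add: cycles_on_def)
    next
      case (Suc k')
      \<comment> \<open>The induction hypothesis with \<open>j = L\<close> completes the growing
        cycle; \<open>b\<close> then starts the next one as a fixed point and becomes the marked
        point.\<close>
      then have "card S' = k' * L + L" using Suc.prems j S by simp
      then obtain p a where p: "p permutes S'" "card (cycles_on S' p) = k"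
        "\<And>x. x \<in> S' \<Longrightarrow> (if a \<in> orbit p x then L else L) \<le> card (orbit p x)"
        using Suc.hyps(1)[OF m Suc.prems(1) Suc.prems(1) S(3)] Suc by blast
      have "p b = b" using p(1) S(2) by (simp add: permutes_not_in)
      then have ob: "orbit p b = {b}" by (simp add: orbit_eq_singleton_iff)
      have "p permutes S" using p(1) S(1) permutes_subset by blast
      moreover have "card (cycles_on S p) = Suc k"
        using card_cycles_on_transpose_comp[OF S(3) p(1) S(2), of b] p(2) S by simp
      moreover have "(if b \<in> orbit p x then j else L) \<le> card (orbit p x)" if "x \<in> S" for x
      proof (cases "x = b")
        case False
        then have "x \<in> S'" using that S by simp
        then show ?thesis using p(3) permutes_orbit_subset[OF p(1)] S(2) by auto
      qed (simp add: ob j)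
      ultimately show ?thesis using S(1) by blast
    qed
  qed
qed

text \<open>The growing cycle absorbs the surplus: take \<open>j\<close> to be
  \<open>card S - (k - 1) * L\<close>, which is at least \<open>L\<close>.\<close>

lemma exists_permutes_long_cycles:
  assumes "1 \<le> L" "1 \<le> k" "finite S" "k * L \<le> card S"
  shows "\<exists>p. p permutes S \<and> card (cycles_on S p) = k \<and> (\<forall>x\<in>S. L \<le> card (orbit p x))"
proof -
  obtain k' where k: "k = Suc k'" using assms(2) by (cases k) auto
  have *: "1 \<le> card S - k' * L" "card S = k' * L + (card S - k' * L)" "L \<le> card S - k' * L"
    using assms k by auto
  obtain p a where "p permutes S" "card (cycles_on S p) = k"
    and p: "\<And>x. x \<in> S \<Longrightarrow> (if a \<in> orbit p x then card S - k' * L else L) \<le> card (orbit p x)"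
    using exists_permutes_long_cycles_aux[OF assms(1) *(1) assms(3) *(2)] k by blast
  moreover have "L \<le> card (orbit p x)" if "x \<in> S" for x
    using p[OF that] *(3) by (auto split: if_splits)
  ultimately show ?thesis by blast
qed

text \<open>Start with long cycles on \<open>S\<close> without \<open>r\<close> and an auxiliary
  point \<open>x\<close>, insert \<open>x\<close> before \<open>s\<close>, then \<open>r\<close>
  before \<open>x\<close>. This creates the path r, x, s, and insertion shortens no cycle.
  Redirecting \<open>r\<close> to \<open>s\<close> will then only skip \<open>x\<close>.\<close>

lemma exists_permutes_long_cycles_two_step:
  fixes S :: "'a set"
  assumes "1 \<le> L" "1 \<le> k" "finite S" "k * L + 2 \<le> card S" "r \<in> S" "s \<in> S" "r \<noteq> s"
  shows "\<exists>p. p permutes S \<and> card (cycles_on S p) = k \<and> (\<forall>x\<in>S. L \<le> card (orbit p x)) \<and> p (p r) = s"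
proof -
  \<comment> \<open>As \<open>k * L\<close> is positive, \<open>S\<close> has at least three points,
    which leaves room for \<open>x\<close>.\<close>
  have kL: "0 < k * L" using assms(1,2) by simp
  have "card (S - {r, s}) = card S - 2" using assms by (simp add: card_Diff_subset)
  then have "card (S - {r, s}) > 0" using assms(4) kL by linarith
  then have "S - {r, s} \<noteq> {}" by (metis card.empty less_numeral_extra(3))
  then obtain x where x: "x \<in> S" "x \<noteq> r" "x \<noteq> s" by blast
  let ?S = "S - {r, x}"
  have "card ?S = card S - 2" using assms x by (simp add: card_Diff_subset)
  then have "k * L \<le> card ?S" using assms(4) by simp
  then obtain p where p: "p permutes ?S" "card (cycles_on ?S p) = k" "\<And>x. x \<in> ?S \<Longrightarrow> L \<le> card (orbit p x)"
    using exists_permutes_long_cycles[OF assms(1,2), of ?S] assms(3) by blast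
  have insert_step: "transpose a b \<circ> p permutes insert a A \<and>
      card (cycles_on (insert a A) (transpose a b \<circ> p)) = k \<and>
      (\<forall>x\<in>insert a A. L \<le> card (orbit (transpose a b \<circ> p) x))"
    if A: "finite A" "a \<notin> A" "b \<in> A" and p: "p permutes A" "card (cycles_on A p) = k"
      "\<forall>x\<in>A. L \<le> card (orbit p x)" for A :: "'a set" and a b p
  proof (intro conjI ballI)
    show "transpose a b \<circ> p permutes insert a A"
      using A(3) by (intro permutes_compose[OF permutes_subset[OF p(1)]] permutes_swap_id) auto
    show "card (cycles_on (insert a A) (transpose a b \<circ> p)) = k"
      using card_cycles_on_transpose_comp[OF A(1) p(1) A(2), of b] A p(2) by auto
    fix y assume "y \<in> insert a A"
    then obtain z where "z \<in> A"
      "card (orbit (transpose a b \<circ> p) y) = card (orbit p z) + of_bool (b \<in> orbit p z)"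
      using card_orbit_transpose_comp[OF A(1) p(1) A(2,3)] by metis
    then show "L \<le> card (orbit (transpose a b \<circ> p) y)" using p(3) by auto
  qed
  let ?T = "insert x ?S"
  let ?q = "transpose x s \<circ> p"
  let ?u = "transpose r x \<circ> ?q"
  have q: "?q permutes ?T \<and> card (cycles_on ?T ?q) = k \<and> (\<forall>y\<in>?T. L \<le> card (orbit ?q y))"
    using assms x p by (intro insert_step) auto
  have T: "insert r ?T = S" using assms x by auto
  have u: "?u permutes insert r ?T \<and> card (cycles_on (insert r ?T) ?u) = k \<and> (\<forall>y\<in>insert r ?T. L \<le> card (orbit ?u y))"
    using assms x q by (intro insert_step) auto
  have "p x = x" "p r = r" using p(1) by (auto simp: permutes_not_in)
  then have "?u (?u r) = s" using x assms(7) by (auto simp: transpose_def)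
  then show ?thesis using u unfolding T by blast
qed

section \<open>Early returns of iterates\<close>

text \<open>Applied in the contrapositive: a point on a long cycle does not return early.\<close>

lemma card_orbit_le_if_funpow_eq:
  assumes "(f ^^ b) x = x" "1 \<le> b"
  shows "card (orbit f x) \<le> b"
proof -
  have "orbit f x \<subseteq> (\<lambda>m. (f ^^ m) x) ` {..<b}"
  proof
    fix y assume "y \<in> orbit f x"
    then obtain m where "y = (f ^^ m) x" by (auto simp: orbit_altdef)
    then have "y = (f ^^ (m mod b)) x" using assms(1) by (simp add: funpow_mod_eq)
    then show "y \<in> (\<lambda>m. (f ^^ m) x) ` {..<b}" using assms(2) by auto
  qed
  then show ?thesis by (metis card_lessThan finite_lessThan surj_card_le)
qed

text \<open>
  Redirecting \<open>r\<close> to \<open>f (f r)\<close> only skips a point, so it at most halves cycle lengths.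
\<close>

lemma funpow_fun_upd_two_step:
  "\<exists>b. a \<le> b \<and> b \<le> 2 * a \<and> ((f (r := f (f r))) ^^ a) y = (f ^^ b) y"
proof (induction a)
  case 0
  then show ?case by (intro exI[of _ 0]) simp
next
  case (Suc a)
  then obtain b where b: "a \<le> b" "b \<le> 2 * a" "((f (r := f (f r))) ^^ a) y = (f ^^ b) y" by blast
  show ?case
  proof (cases "(f ^^ b) y = r")
    case True
    then show ?thesis using b by (intro exI[of _ "b + 2"]) (simp del: fun_upd_apply, simp)
  next
    case False
    then show ?thesis using b by (intro exI[of _ "b + 1"]) (simp del: fun_upd_apply, simp)
  qed
qed

section \<open>A Stirling number inequality\<close>

text \<open>
  In a random permutation of \<open>Suc m\<close> points with \<open>Suc l\<close> cycles, a given point is fixed with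
  probability at most \<open>Suc l / Suc m\<close>, there being at most \<open>Suc l\<close> fixed points.
\<close>

lemma stirling_mult_le: "Suc m * stirling m l \<le> Suc l * stirling (Suc m) (Suc l)"
proof (induction m arbitrary: l)
  case 0
  then show ?case by (cases l) auto
next
  case (Suc m)
  note IH = Suc.IH
  show ?case
  proof (cases "l \<le> Suc m")
    case False
    then show ?thesis by simp
  next
    case True
    let ?X = "real (stirling (Suc m) l)" and ?Y = "real (stirling m l)"
    have IH1: "(m + 1) * ?Y \<le> (l + 1) * real (stirling (Suc m) (Suc l))"
      using of_nat_mono[OF Suc[of l], where 'a = real] by (simp add: algebra_simps)
    \<comment> \<open>By the recurrence, the goal amounts to (m+1-l) X \<le> (m+1)(l+1) c(m+1,l+1).
      Here the fixed-point term Z of X = mY + Z is absorbed, the induction hypothesis at l-1 giving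
      (m+1) Z \<le> l X.\<close>
    have XY: "(m + 1 - real l) * ?X \<le> (m + 1) * (m * ?Y)"
    proof (cases l)
      case 0
      then show ?thesis by (cases m) auto
    next
      case (Suc l')
      let ?Z = "real (stirling m l')"
      have "real (Suc m * stirling m l') \<le> real (Suc l' * stirling (Suc m) (Suc l'))"
        using IH by (rule of_nat_mono)
      then have "(m + 1) * ?Z \<le> l * ?X" using Suc by (simp add: algebra_simps)
      moreover have "?X = m * ?Y + ?Z" using Suc by simp
      ultimately show ?thesis by (simp add: algebra_simps)
    qed
    have "m * ?Y \<le> (m + 1) * ?Y" by (simp add: algebra_simps)
    then have "(m + 1) * (m * ?Y) \<le> (m + 1) * ((m + 1) * ?Y)" by (intro mult_left_mono) auto
    also have "\<dots> \<le> (m + 1) * ((l + 1) * real (stirling (Suc m) (Suc l)))"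
      using IH1 by (intro mult_left_mono) auto
    finally have "(m + 1 - real l) * ?X \<le> (m + 1) * ((l + 1) * real (stirling (Suc m) (Suc l)))"
      using XY by linarith
    then have "real (Suc (Suc m) * stirling (Suc m) l) \<le> real (Suc l * stirling (Suc (Suc m)) (Suc l))"
      by (simp add: algebra_simps)
    then show ?thesis by (simp only: of_nat_le_iff)
  qed
qed

section \<open>Bonferroni inequalities\<close>

lemma alternating_sum_binomial_Suc:
  "(\<Sum>j\<le>J. (- 1) ^ j * real (Suc M choose j)) = (- 1) ^ J * real (M choose J)"
  by (induction J) (auto simp: algebra_simps)

text \<open>This is truncated inclusion-exclusion at a single outcome where \<open>N\<close> events
  occur. For positive \<open>N\<close> the sum is a binomial coefficient with sign (-1)^J; for
  \<open>N = 0\<close> it is exactly 1.\<close>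

lemma of_bool_alternating_sum:
  shows "even J \<Longrightarrow> of_bool (N = 0) \<le> (\<Sum>j\<le>J. (- 1) ^ j * real (N choose j))"
    and "odd J \<Longrightarrow> (\<Sum>j\<le>J. (- 1) ^ j * real (N choose j)) \<le> of_bool (N = 0)"
proof -
  have "(\<Sum>j\<le>J. (- 1) ^ j * real (N choose j)) = 1" if "N = 0"
    using that by (induction J) auto
  then show "even J \<Longrightarrow> of_bool (N = 0) \<le> (\<Sum>j\<le>J. (- 1) ^ j * real (N choose j))"
    and "odd J \<Longrightarrow> (\<Sum>j\<le>J. (- 1) ^ j * real (N choose j)) \<le> of_bool (N = 0)"
    by (cases N; simp add: alternating_sum_binomial_Suc del: binomial_Suc_Suc)+
qed

text \<open>Both sides count pairs of an outcome \<open>t\<close> and a \<open>j\<close>-set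
  \<open>I\<close> of events that all occur at \<open>t\<close>.\<close>

lemma sum_binomial_double_count:
  fixes R :: "'b \<Rightarrow> 'a \<Rightarrow> bool"
  assumes "finite E" "finite T"
  shows "(\<Sum>t\<in>T. card {i\<in>E. R t i} choose j) =
    (\<Sum>I | I \<subseteq> E \<and> card I = j. card {t\<in>T. \<forall>i\<in>I. R t i})"
proof -
  let ?P = "{I. I \<subseteq> E \<and> card I = j}"
  have P: "finite ?P" using assms(1) by simp
  have "(card {i\<in>E. R t i} choose j) = (\<Sum>I\<in>?P. of_bool (\<forall>i\<in>I. R t i))" for t
  proof -
    have "(card {i\<in>E. R t i} choose j) = card {I. I \<subseteq> {i\<in>E. R t i} \<and> card I = j}"
      using assms(1) by (simp add: n_subsets)
    also have "{I. I \<subseteq> {i\<in>E. R t i} \<and> card I = j} = ?P \<inter> {I. \<forall>i\<in>I. R t i}" by auto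
    finally show ?thesis using P by (simp add: sum_of_bool_eq)
  qed
  then have "(\<Sum>t\<in>T. card {i\<in>E. R t i} choose j) =
      (\<Sum>t\<in>T. \<Sum>I\<in>?P. of_bool (\<forall>i\<in>I. R t i))" by simp
  also have "\<dots> = (\<Sum>I\<in>?P. \<Sum>t\<in>T. of_bool (\<forall>i\<in>I. R t i))" by (rule sum.swap)
  also have "\<dots> = (\<Sum>I\<in>?P. card {t\<in>T. \<forall>i\<in>I. R t i})"
    using assms(2) by (simp add: sum_of_bool_eq Int_def)
  finally show ?thesis .
qed

text \<open>The pointwise inequalities are summed over \<open>T\<close>. Joint counts depend only on
  the number of events, so the \<open>j\<close>-th binomial moment collapses to
  \<open>(card E choose j) * b j\<close>.\<close>

lemma bonferroni:
  fixes R :: "'b \<Rightarrow> 'a \<Rightarrow> bool"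
  assumes "finite E" "finite T"
    and b: "\<And>I. I \<subseteq> E \<Longrightarrow> card I \<le> J \<Longrightarrow> card {t\<in>T. \<forall>i\<in>I. R t i} = b (card I)"
  defines "\<Sigma> \<equiv> \<Sum>j\<le>J. (- 1) ^ j * real ((card E choose j) * b j)"
  shows "even J \<Longrightarrow> real (card {t\<in>T. \<forall>i\<in>E. \<not> R t i}) \<le> \<Sigma>"
    and "odd J \<Longrightarrow> \<Sigma> \<le> real (card {t\<in>T. \<forall>i\<in>E. \<not> R t i})"
proof -
  let ?N = "\<lambda>t. card {i\<in>E. R t i}"
  have "{t\<in>T. \<forall>i\<in>E. \<not> R t i} = T \<inter> {t. ?N t = 0}" using assms(1) by auto
  then have avoid: "real (card {t\<in>T. \<forall>i\<in>E. \<not> R t i}) = (\<Sum>t\<in>T. of_bool (?N t = 0))"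
    using assms(2) by (simp add: sum_of_bool_eq)
  have "(\<Sum>t\<in>T. ?N t choose j) = (card E choose j) * b j" if "j \<le> J" for j
  proof -
    have "(\<Sum>t\<in>T. ?N t choose j) = (\<Sum>I | I \<subseteq> E \<and> card I = j. b j)"
      unfolding sum_binomial_double_count[OF assms(1,2)] using b that by (intro sum.cong) auto
    then show ?thesis using assms(1) by (simp add: n_subsets)
  qed
  then have "\<Sigma> = (\<Sum>j\<le>J. (- 1) ^ j * real (\<Sum>t\<in>T. ?N t choose j))"
    unfolding \<Sigma>_def by (intro sum.cong) auto
  also have "\<dots> = (\<Sum>t\<in>T. \<Sum>j\<le>J. (- 1) ^ j * real (?N t choose j))"
    by (simp add: sum_distrib_left) (rule sum.swap)
  finally have \<Sigma>: "\<Sigma> = (\<Sum>t\<in>T. \<Sum>j\<le>J. (- 1) ^ j * real (?N t choose j))" .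
  show "even J \<Longrightarrow> real (card {t\<in>T. \<forall>i\<in>E. \<not> R t i}) \<le> \<Sigma>"
    unfolding avoid \<Sigma> by (intro sum_mono of_bool_alternating_sum)
  show "odd J \<Longrightarrow> \<Sigma> \<le> real (card {t\<in>T. \<forall>i\<in>E. \<not> R t i})"
    unfolding avoid \<Sigma> by (intro sum_mono of_bool_alternating_sum)
qed

section \<open>Size of the factorial moments\<close>

text \<open>\<open>F j\<close> is the \<open>j\<close>-th factorial moment for \<open>m - 1\<close>
  events. Absorption in the binomial coefficient and the Stirling recurrence leave a difference of
  j! (m-1 choose j) c(m-j-1,l), the fixed-point term that \<open>stirling_mult_le\<close>
  bounds.\<close>

lemma falling_stirling_step:
  fixes m l j :: nat
  defines "F \<equiv> \<lambda>j. fact j * real (((m - 1) choose j) * stirling (m - j) (Suc l))"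
  assumes "j < m"
  shows "F (Suc j) \<le> F j" and "real (m - j) * (F j - F (Suc j)) \<le> real (Suc l) * F j"
proof -
  obtain q where q: "m - j = Suc q" using assms(2) by (metis Suc_diff_Suc)
  let ?A = "fact j * real ((m - 1) choose j)"
  have q': "m - Suc j = q" "m - 1 - j = q" using q by auto
  have "Suc j * ((m - 1) choose Suc j) = q * ((m - 1) choose j)"
  proof (cases "m - 1")
    case 0
    then show ?thesis using q' by simp
  next
    case (Suc n)
    then show ?thesis
      using binomial_absorb_comp[of "m - 1" j] Suc_times_binomial[of j n] q'(2) by simp
  qed
  then have binom: "real (Suc j) * real ((m - 1) choose Suc j) = real q * real ((m - 1) choose j)"
    by (metis of_nat_mult)
  have "F (Suc j) = fact j * ((real (Suc j) * real ((m - 1) choose Suc j)) * real (stirling q (Suc l)))"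
    unfolding F_def q' fact_Suc of_nat_mult by (simp only: mult_ac)
  then have FS: "F (Suc j) = ?A * (q * real (stirling q (Suc l)))"
    unfolding binom by (simp only: mult_ac)
  have F: "F j = ?A * real (stirling (Suc q) (Suc l))" unfolding F_def q by simp
  have st: "real (stirling (Suc q) (Suc l)) = q * real (stirling q (Suc l)) + real (stirling q l)"
    by simp
  have diff: "F j - F (Suc j) = ?A * real (stirling q l)"
    unfolding F FS st by (simp add: algebra_simps)
  then have "F j - F (Suc j) \<ge> 0" by simp
  then show "F (Suc j) \<le> F j" by simp
  have "real (Suc q * stirling q l) \<le> real (Suc l * stirling (Suc q) (Suc l))"
    using stirling_mult_le by (rule of_nat_mono)
  then have "?A * (real (Suc q) * real (stirling q l)) \<le> ?A * (real (Suc l) * real (stirling (Suc q) (Suc l)))"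
    unfolding of_nat_mult by (rule mult_left_mono) simp
  then show "real (m - j) * (F j - F (Suc j)) \<le> real (Suc l) * F j"
    unfolding diff unfolding F q by (simp only: mult_ac)
qed

text \<open>Here \<delta> bounds (l+1)/(m-j) uniformly for j \<le> J, so each step from
  \<open>F j\<close> to \<open>F (Suc j)\<close> loses at most \<delta> times c(m,l+1), and the
  losses add up.\<close>

lemma falling_stirling_bounds:
  fixes m l j :: nat and \<delta> :: real
  assumes "j \<le> J" "J < m" "0 \<le> \<delta>" "real (Suc l) \<le> \<delta> * real (m - J)"
  shows "fact j * real (((m - 1) choose j) * stirling (m - j) (Suc l)) \<le> stirling m (Suc l)"
    and "(1 - j * \<delta>) * stirling m (Suc l) \<le> fact j * real (((m - 1) choose j) * stirling (m - j) (Suc l))"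
proof -
  define F where "F j = fact j * real (((m - 1) choose j) * stirling (m - j) (Suc l))" for j
  let ?C = "real (stirling m (Suc l))"
  have F0: "F 0 = ?C" by (simp add: F_def)
  have "F j \<le> ?C \<and> (1 - j * \<delta>) * ?C \<le> F j" using assms(1)
  proof (induction j)
    case 0
    then show ?case by (simp add: F0)
  next
    case (Suc j)
    then have IH: "F j \<le> ?C" "(1 - j * \<delta>) * ?C \<le> F j" by auto
    have j: "j < m" "real (m - J) \<le> real (m - j)" "0 < real (m - J)" using Suc.prems assms(2) by auto
    have step: "F (Suc j) \<le> F j" "real (m - j) * (F j - F (Suc j)) \<le> real (Suc l) * F j"
      using falling_stirling_step[OF j(1), of l] unfolding F_def by auto
    have "real (m - J) * (F j - F (Suc j)) \<le> real (m - j) * (F j - F (Suc j))"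
      using step(1) j(2) by (intro mult_right_mono) auto
    also have "\<dots> \<le> real (Suc l) * F j" by (rule step(2))
    also have "\<dots> \<le> (\<delta> * real (m - J)) * ?C"
      by (rule mult_mono[OF assms(4) IH(1)]) (use assms(3) in \<open>simp_all add: F_def\<close>)
    finally have "real (m - J) * (F j - F (Suc j)) \<le> real (m - J) * (\<delta> * ?C)" by (simp add: mult_ac)
    then have "F j - F (Suc j) \<le> \<delta> * ?C" using j(3) by (rule mult_left_le_imp_le)
    then show ?case using IH step(1) by (simp add: algebra_simps)
  qed
  then show "fact j * real (((m - 1) choose j) * stirling (m - j) (Suc l)) \<le> stirling m (Suc l)"
    and "(1 - j * \<delta>) * stirling m (Suc l) \<le> fact j * real (((m - 1) choose j) * stirling (m - j) (Suc l))"
    unfolding F_def by auto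
qed

text \<open>Each of the J+1 terms is off by at most J \<delta> c(m,l+1); dividing by j! only shrinks
  the error.\<close>

lemma alternating_sum_stirling_approx:
  fixes m l J :: nat and \<delta> :: real
  assumes "J < m" "0 \<le> \<delta>" "real (Suc l) \<le> \<delta> * real (m - J)"
  shows "\<bar>(\<Sum>j\<le>J. (- 1) ^ j * real (((m - 1) choose j) * stirling (m - j) (Suc l))) -
      (\<Sum>j\<le>J. (- 1) ^ j / fact j) * real (stirling m (Suc l))\<bar>
    \<le> (J + 1) * J * \<delta> * stirling m (Suc l)"
proof -
  let ?C = "real (stirling m (Suc l))"
  let ?B = "\<lambda>j. real (((m - 1) choose j) * stirling (m - j) (Suc l))"
  have summand: "\<bar>(- 1) ^ j * ?B j - (- 1) ^ j / fact j * ?C\<bar> \<le> J * \<delta> * ?C" if "j \<le> J" for j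
  proof -
    have f: "1 \<le> (fact j :: real)" by (rule fact_ge_1)
    have "j * (\<delta> * ?C) \<le> J * (\<delta> * ?C)" using that assms(2) by (intro mult_right_mono) auto
    then have "\<bar>fact j * ?B j - ?C\<bar> \<le> J * \<delta> * ?C"
      using falling_stirling_bounds[OF that assms] by (simp add: algebra_simps)
    moreover have "(- 1) ^ j * ?B j - (- 1) ^ j / fact j * ?C = (- 1) ^ j * (fact j * ?B j - ?C) / fact j"
      by (simp add: field_simps)
    then have "\<bar>(- 1) ^ j * ?B j - (- 1) ^ j / fact j * ?C\<bar> = \<bar>fact j * ?B j - ?C\<bar> / fact j"
      by (simp add: abs_mult)
    moreover have "\<bar>fact j * ?B j - ?C\<bar> / fact j \<le> \<bar>fact j * ?B j - ?C\<bar>"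
      using f by (simp add: divide_le_eq mult_le_cancel_left1)
    ultimately show ?thesis by linarith
  qed
  have "\<bar>(\<Sum>j\<le>J. (- 1) ^ j * ?B j) - (\<Sum>j\<le>J. (- 1) ^ j / fact j) * ?C\<bar> =
      \<bar>\<Sum>j\<le>J. (- 1) ^ j * ?B j - (- 1) ^ j / fact j * ?C\<bar>"
    by (simp add: sum_subtractf sum_distrib_right)
  also have "\<dots> \<le> (\<Sum>j\<le>J. \<bar>(- 1) ^ j * ?B j - (- 1) ^ j / fact j * ?C\<bar>)" by (rule sum_abs)
  also have "\<dots> \<le> (\<Sum>j\<le>J. J * \<delta> * ?C)" using summand by (intro sum_mono) auto
  finally show ?thesis by (simp add: algebra_simps)
qed

section \<open>Agreement counts for the chosen permutation\<close>

text \<open>For \<open>r = s\<close> the fixed point is removed, which costs one point and one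
  cycle; otherwise r to s is one more prescribed edge. That makes up to J+1 edges, and J+1
  redirected steps can equal 2J+2 steps of \<pi>, whence cycle length 2J+3. The extra 2 pays for
  \<open>r\<close> and the auxiliary point between \<open>r\<close> and \<open>s\<close>.\<close>

lemma exists_admissible_with_exact_counts:
  assumes "1 \<le> k" "k * (2 * J + 3) + 2 \<le> n" "r \<in> {1..n}" "s \<in> {1..n}" "k = 1 \<Longrightarrow> r \<noteq> s"
  shows "\<exists>\<pi>\<in>Sym n k. admissible_triple n k r s \<pi> \<and>
    (\<forall>I. I \<subseteq> {i \<in> {1..n}. i \<noteq> r \<and> \<pi> i \<noteq> s} \<and> card I \<le> J \<longrightarrow>
      card {\<tau> \<in> Sym n k. \<tau> r = s \<and> (\<forall>i\<in>I. \<tau> i = \<pi> i)} =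
        stirling (n - 1 - card I) (k - of_bool (r = s)))"
proof (cases "r = s")
  case True
  let ?S = "{1..n}" and ?L = "2 * J + 3"
  obtain \<pi> where p: "\<pi> permutes ?S" "card (cycles_on ?S \<pi>) = k" "\<And>x. x \<in> ?S \<Longrightarrow> ?L \<le> card (orbit \<pi> x)"
    using exists_permutes_long_cycles[of ?L k ?S] assms by auto
  have nofix: "(\<pi> ^^ b) x \<noteq> x" if "x \<in> ?S" "1 \<le> b" "b < ?L" for x b
    using card_orbit_le_if_funpow_eq[of b \<pi> x] p(3)[OF that(1)] that(2,3) by force
  have "\<pi> r \<noteq> s" using nofix[OF assms(3), of 1] True by simp
  then have adm: "admissible_triple n k r s \<pi>" "\<pi> \<in> Sym n k"
    using p assms by (auto simp: admissible_triple_def Sym_def)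
  have "card {\<tau> \<in> Sym n k. \<tau> r = s \<and> (\<forall>i\<in>I. \<tau> i = \<pi> i)} = stirling (n - 1 - card I) (k - 1)"
    if I: "I \<subseteq> {i \<in> ?S. i \<noteq> r \<and> \<pi> i \<noteq> s}" "card I \<le> J" for I
  proof -
    let ?S' = "?S - {r}"
    have ins: "insert r ?S' = ?S" "finite ?S'" "r \<notin> ?S'" "r \<in> insert r ?S'" using assms(3) by auto
    \<comment> \<open>With both points equal to \<open>r\<close> the transposition is the identity,
      so the insertion lemma just adds the fixed point \<open>r\<close>.\<close>
    have cyc: "\<tau> permutes ?S' \<Longrightarrow> card (cycles_on ?S \<tau>) = Suc (card (cycles_on ?S' \<tau>))" for \<tau>
      using card_cycles_on_transpose_comp[OF ins(2) _ ins(3,4), of \<tau>] ins(1) by simp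
    have perm: "\<tau> permutes ?S' \<longleftrightarrow> \<tau> permutes ?S \<and> \<tau> r = r" for \<tau>
    proof
      assume "\<tau> permutes ?S'"
      then show "\<tau> permutes ?S \<and> \<tau> r = r"
        using permutes_subset[of \<tau> ?S' ?S] by (auto simp: permutes_not_in)
    next
      assume "\<tau> permutes ?S \<and> \<tau> r = r"
      then show "\<tau> permutes ?S'" by (auto intro: permutes_superset)
    qed
    have finI: "finite I" using I(1) by (rule finite_subset) simp
    have "(\<pi> ^^ a) x \<noteq> x" if "x \<in> I" "1 \<le> a" "a \<le> card I" for x a
      using that I by (intro nofix) auto
    then obtain h :: "nat \<Rightarrow> nat" where h: "\<And>x. x \<in> I \<Longrightarrow> h (\<pi> x) < h x"
      using exists_rank_function[OF finI, of \<pi>] by blast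
    have "{\<tau> \<in> Sym n k. \<tau> r = s \<and> (\<forall>i\<in>I. \<tau> i = \<pi> i)} =
        {\<tau>. \<tau> permutes ?S' \<and> card (cycles_on ?S' \<tau>) = k - 1 \<and> (\<forall>i\<in>I. \<tau> i = \<pi> i)}"
      using cyc perm assms(1) True by (auto simp: Sym_def)
    also have "card \<dots> = stirling (card ?S' - card I) (k - 1)"
    proof (rule card_permutes_extending)
      show "I \<subseteq> ?S'" using I by auto
      show "\<pi> ` I \<subseteq> ?S'" using I True permutes_in_image[OF p(1)] by blast
      show "inj_on \<pi> I" using p(1) by (auto intro: inj_on_subset[OF permutes_inj])
    qed (use h in auto)
    finally show ?thesis using assms(3) by simp
  qed
  then show ?thesis using adm True by auto
next
  case False
  let ?S = "{1..n}" and ?L = "2 * J + 3"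
  obtain \<pi> where p: "\<pi> permutes ?S" "card (cycles_on ?S \<pi>) = k" "\<And>x. x \<in> ?S \<Longrightarrow> ?L \<le> card (orbit \<pi> x)"
    "\<pi> (\<pi> r) = s"
    using exists_permutes_long_cycles_two_step[of ?L k ?S r s] assms False by auto
  have nofix: "(\<pi> ^^ b) x \<noteq> x" if "x \<in> ?S" "1 \<le> b" "b < ?L" for x b
    using card_orbit_le_if_funpow_eq[of b \<pi> x] p(3)[OF that(1)] that(2,3) by force
  \<comment> \<open>Otherwise \<pi> s = \<pi> (\<pi> r) = s would be a fixed point.\<close>
  have rs: "\<pi> r \<noteq> s" using nofix[OF assms(4), of 1] p(1,4) by (auto dest: permutes_inj injD)
  then have adm: "admissible_triple n k r s \<pi>" "\<pi> \<in> Sym n k"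
    using p assms by (auto simp: admissible_triple_def Sym_def)
  \<comment> \<open>Since \<pi> (\<pi> r) = s, this single map encodes both the edge from
    \<open>r\<close> to \<open>s\<close> and the agreements with \<pi>.\<close>
  let ?f = "\<pi> (r := \<pi> (\<pi> r))"
  have nofix_f: "(?f ^^ a) x \<noteq> x" if "x \<in> ?S" "1 \<le> a" "a \<le> Suc J" for x a
  proof -
    obtain b where "a \<le> b" "b \<le> 2 * a" "(?f ^^ a) x = (\<pi> ^^ b) x"
      using funpow_fun_upd_two_step[of a \<pi> r x] by blast
    then show ?thesis using nofix[OF that(1), of b] that(2,3) by auto
  qed
  have "card {\<tau> \<in> Sym n k. \<tau> r = s \<and> (\<forall>i\<in>I. \<tau> i = \<pi> i)} = stirling (n - 1 - card I) k"
    if I: "I \<subseteq> {i \<in> ?S. i \<noteq> r \<and> \<pi> i \<noteq> s}" "card I \<le> J" for I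
  proof -
    let ?D = "insert r I"
    have finI: "finite I" using I(1) by (rule finite_subset) simp
    have rI: "r \<notin> I" using I by auto
    have D: "?D \<subseteq> ?S" "finite ?D" "card ?D \<le> Suc J" using I finI rI assms(3) by auto
    have "(?f ^^ a) x \<noteq> x" if "x \<in> ?D" "1 \<le> a" "a \<le> card ?D" for x a
      using that D(1,3) by (intro nofix_f) auto
    then obtain h :: "nat \<Rightarrow> nat" where h: "\<And>x. x \<in> ?D \<Longrightarrow> h (?f x) < h x"
      using exists_rank_function[OF D(2), of ?f] by blast
    have "{\<tau> \<in> Sym n k. \<tau> r = s \<and> (\<forall>i\<in>I. \<tau> i = \<pi> i)} =
        {\<tau>. \<tau> permutes ?S \<and> card (cycles_on ?S \<tau>) = k \<and> (\<forall>i\<in>?D. \<tau> i = ?f i)}"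
      using rI p(4) by (auto simp: Sym_def)
    also have "card \<dots> = stirling (card ?S - card ?D) k"
    proof (rule card_permutes_extending)
      have "?f x \<in> ?S" if "x \<in> ?S" for x
        using that assms(3) by (simp only: fun_upd_apply permutes_in_image[OF p(1)] simp_thms split: if_split)
      then show "?f ` ?D \<subseteq> ?S" using D(1) by blast
      have "inj_on \<pi> I" using p(1) by (auto intro: inj_on_subset[OF permutes_inj])
      then show "inj_on ?f ?D" using I p(4) rI by (auto simp: inj_on_def)
      show "h (?f x) < h x" if "x \<in> ?D" for x using that by (rule h)
    qed (use D in auto)
    finally show ?thesis using finI rI by simp
  qed
  then show ?thesis using adm False by auto
qed

section \<open>From agreement counts to the size of the meeting family\<close>

text \<open>Among the \<open>C\<close> permutations with \<tau> r = s, those meeting \<pi> are the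
  complement of those avoiding it, so an upper Bonferroni bound (even \<open>J\<close>) becomes a
  lower bound for \<open>M\<close>, and conversely. The constant \<open>c\<close> will be 1/e; \<xi>
  covers the series error plus the Stirling error.\<close>

lemma card_Sym_meeting_approx:
  fixes \<delta> c :: real
  assumes p: "\<pi> permutes {1..n}" and rs: "r \<in> {1..n}" "s \<in> {1..n}" "\<pi> r \<noteq> s"
    and cnt: "\<And>I. I \<subseteq> {i \<in> {1..n}. i \<noteq> r \<and> \<pi> i \<noteq> s} \<Longrightarrow> card I \<le> J \<Longrightarrow>
      card {\<tau> \<in> Sym n k. \<tau> r = s \<and> (\<forall>i\<in>I. \<tau> i = \<pi> i)} = stirling (n - 1 - card I) (Suc l)"
    and J: "J < n - 1" and \<delta>: "0 \<le> \<delta>" "real (Suc l) \<le> \<delta> * real (n - 1 - J)"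
    and c: "\<bar>(\<Sum>j\<le>J. (- 1) ^ j / fact j) - c\<bar> + real ((J + 1) * J) * \<delta> \<le> \<xi>"
  defines "C \<equiv> real (stirling (n - 1) (Suc l))" and "M \<equiv> real (card (Sym_meeting n k r s \<pi>))"
  shows "even J \<Longrightarrow> (1 - c - \<xi>) * C \<le> M" and "odd J \<Longrightarrow> M \<le> (1 - c + \<xi>) * C"
proof -
  let ?E = "{i \<in> {1..n}. i \<noteq> r \<and> \<pi> i \<noteq> s}" and ?T = "{\<tau> \<in> Sym n k. \<tau> r = s}"
  let ?avoid = "{\<tau> \<in> ?T. \<forall>i\<in>?E. \<not> \<tau> i = \<pi> i}"
  let ?\<Sigma> = "\<Sum>j\<le>J. (- 1) ^ j * real ((card ?E choose j) * stirling (n - 1 - j) (Suc l))"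
  let ?e = "\<Sum>j\<le>J. (- 1) ^ j / fact j :: real"
  \<comment> \<open>The preimage \<open>t\<close> of \<open>s\<close> differs from \<open>r\<close>
    because \<pi> r \<noteq> s. Hence \<open>?E\<close> has n-2 elements, the number of events in
    the moment estimates for m = n-1.\<close>
  have "s \<in> \<pi> ` {1..n}" using rs(2) by (simp only: permutes_image[OF p])
  then obtain t where t: "t \<in> {1..n}" "\<pi> t = s" by blast
  have "\<pi> i \<noteq> s \<longleftrightarrow> i \<noteq> t" for i using t(2) injD[OF permutes_inj[OF p]] by blast
  then have "?E = {i \<in> {1..n}. i \<noteq> r \<and> i \<noteq> t}" by (simp only:)
  also have "\<dots> = {1..n} - {r, t}" by blast
  finally have E: "?E = {1..n} - {r, t}" .
  have "r \<noteq> t" using rs(3) t(2) by blast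
  then have card_E: "card ?E = n - 1 - 1" using rs(1) t(1) unfolding E by (simp add: card_Diff_subset)
  have finT: "finite ?T"
    using finite_permutations[of "{1..n}"] by (rule finite_subset[rotated]) (auto simp: Sym_def)
  have card_T: "real (card ?T) = C" using cnt[of "{}"] by (simp add: C_def)
  have "Sym_meeting n k r s \<pi> = ?T - ?avoid"
  proof -
    \<comment> \<open>Agreement at \<open>r\<close> contradicts \<pi> r \<noteq> s, and agreement
      where \<pi> i = s forces i = r by injectivity of \<tau>. So every agreement lies in
      \<open>?E\<close>.\<close>
    have "i \<noteq> r \<and> \<pi> i \<noteq> s" if "\<tau> \<in> ?T" "\<tau> i = \<pi> i" for \<tau> i
    proof -
      have "inj \<tau>" "\<tau> r = s" using that(1) permutes_inj by (auto simp: Sym_def)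
      then show ?thesis using that(2) rs(3) by (metis injD)
    qed
    then show ?thesis unfolding Sym_meeting_def by blast
  qed
  moreover have avoid: "?avoid \<subseteq> ?T" by blast
  ultimately have "card (Sym_meeting n k r s \<pi>) = card ?T - card ?avoid"
    using card_Diff_subset[OF finite_subset[OF avoid finT] avoid] by simp
  moreover have "card ?avoid \<le> card ?T" using finT avoid by (rule card_mono)
  ultimately have M: "M = C - card ?avoid" using card_T by (simp add: M_def)
  have "\<bar>?\<Sigma> - ?e * C\<bar> \<le> real ((J + 1) * J) * \<delta> * C"
    using alternating_sum_stirling_approx[OF J \<delta>] unfolding card_E C_def .
  moreover have "\<bar>?e * C - c * C\<bar> = \<bar>?e - c\<bar> * C"
    by (simp add: C_def abs_mult flip: left_diff_distrib)
  moreover have "(\<bar>?e - c\<bar> + real ((J + 1) * J) * \<delta>) * C \<le> \<xi> * C"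
    by (rule mult_right_mono[OF c]) (simp add: C_def)
  ultimately have approx: "\<bar>?\<Sigma> - c * C\<bar> \<le> \<xi> * C" by (simp add: distrib_right)
  have cnt': "card {\<tau> \<in> ?T. \<forall>i\<in>I. \<tau> i = \<pi> i} = stirling (n - 1 - card I) (Suc l)"
    if "I \<subseteq> ?E" "card I \<le> J" for I
    using cnt[OF that] by (simp add: conj_ac)
  have finE: "finite ?E" by simp
  note bonf = bonferroni[where R = "\<lambda>\<tau> i. \<tau> i = \<pi> i" and b = "\<lambda>j. stirling (n - 1 - j) (Suc l)",
      OF finE finT]
  have "real (card ?avoid) \<le> ?\<Sigma>" if "even J"
    using bonf(1)[of J] cnt' that by blast
  then show "even J \<Longrightarrow> (1 - c - \<xi>) * C \<le> M"
    using approx M unfolding left_diff_distrib mult_1 by linarith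
  have "?\<Sigma> \<le> real (card ?avoid)" if "odd J"
    using bonf(2)[of J] cnt' that by blast
  then show "odd J \<Longrightarrow> M \<le> (1 - c + \<xi>) * C"
    using approx M unfolding left_diff_distrib distrib_right mult_1 by linarith
qed

section \<open>Choice of the constants and conclusion\<close>

text \<open>Two consecutive truncations of the series for exp(-1) are needed, as the lower and upper
  estimates require opposite parities.\<close>

lemma exists_even_alternating_exp_approx:
  assumes "0 < \<epsilon>"
  shows "\<exists>J. even J \<and> \<bar>(\<Sum>j\<le>J. (- 1) ^ j / fact j) - 1 / exp 1\<bar> < (\<epsilon> :: real) \<and>
    \<bar>(\<Sum>j\<le>Suc J. (- 1) ^ j / fact j) - 1 / exp 1\<bar> < \<epsilon>"
proof -
  have "(\<lambda>n. (- 1) ^ n /\<^sub>R fact n) sums exp (- 1 :: real)" by (rule exp_converges)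
  then have "(\<lambda>J. \<Sum>j\<le>J. (- 1) ^ j / fact j) \<longlonglongrightarrow> 1 / exp (1 :: real)"
    by (simp add: sums_def_le exp_minus field_simps)
  then obtain N where "\<forall>n\<ge>N. \<bar>(\<Sum>j\<le>n. (- 1) ^ j / fact j) - 1 / exp 1\<bar> < \<epsilon>"
    using LIMSEQ_D[of _ "1 / exp (1 :: real)" \<epsilon>] assms unfolding real_norm_def by blast
  then show ?thesis by (intro exI[of _ "2 * N"]) (simp del: sum.atMost_Suc)
qed

lemma eventually_powr_le_linear:
  fixes \<alpha> a b :: real
  assumes "\<alpha> < 1" "0 < a"
  shows "\<forall>\<^sub>F n in sequentially. real n powr \<alpha> \<le> a * real n - b"
  using assms by real_asymp

theorem lemma3p6:
  fixes \<xi> \<alpha> :: real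
  assumes "0 < \<xi>" and "\<xi> < 0.5"
    and "0 < \<alpha>" and "\<alpha> < 1"
  shows "\<exists>N::nat. \<forall>n\<ge>N. \<forall>k::nat. 1 \<le> k \<and> real k \<le> real n powr \<alpha> \<longrightarrow>
    (\<forall>r\<in>{1..n}. \<forall>s\<in>{1..n}. (k = 1 \<longrightarrow> r \<noteq> s) \<longrightarrow>
      (\<exists>\<pi> \<in> Sym n k. admissible_triple n k r s \<pi> \<and>
        (1 - 1 / exp 1 - \<xi>) * real (stirling (n - 1) (k - of_bool (r = s)))
          \<le> real (card (Sym_meeting n k r s \<pi>)) \<and>
        real (card (Sym_meeting n k r s \<pi>))
          \<le> (1 - 1 / exp 1 + \<xi>) * real (stirling (n - 1) (k - of_bool (r = s)))))"
proof -
  obtain J where J: "even J"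
    "\<bar>(\<Sum>j\<le>J. (- 1) ^ j / fact j) - 1 / exp 1\<bar> < \<xi> / 2"
    "\<bar>(\<Sum>j\<le>Suc J. (- 1) ^ j / fact j) - 1 / exp 1\<bar> < \<xi> / 2"
    using exists_even_alternating_exp_approx[OF half_gt_zero[OF assms(1)]] by blast
  \<comment> \<open>This makes the Stirling error of the longer truncation \<open>Suc J\<close>
    equal to \<xi>/2; the other half of \<xi> is for the series.\<close>
  define \<delta> where "\<delta> = \<xi> / (2 * ((real J + 2) * (real J + 1)))"
  have \<delta>: "0 < \<delta>" "(real J + 2) * (real J + 1) * \<delta> = \<xi> / 2"
    using assms(1) by (auto simp: \<delta>_def)
  have d2: "(Suc J + 1) * Suc J * \<delta> = \<xi> / 2" using \<delta>(2) by (simp add: algebra_simps)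
  moreover have "(J + 1) * J * \<delta> \<le> (Suc J + 1) * Suc J * \<delta>"
    using \<delta>(1) by (intro mult_right_mono) (auto simp: algebra_simps)
  ultimately have d1: "(J + 1) * J * \<delta> \<le> \<xi> / 2" by simp
  have err: "\<bar>(\<Sum>j\<le>J. (- 1) ^ j / fact j) - 1 / exp 1\<bar> + (J + 1) * J * \<delta> \<le> \<xi>"
    using add_mono[OF less_imp_le[OF J(2)] d1] unfolding field_sum_of_halves .
  have err': "\<bar>(\<Sum>j\<le>Suc J. (- 1) ^ j / fact j) - 1 / exp 1\<bar> + (Suc J + 1) * Suc J * \<delta> \<le> \<xi>"
    using add_mono[OF less_imp_le[OF J(3)] eq_refl[OF d2]] unfolding field_sum_of_halves .
  define L where "L = 2 * Suc J + 3"
  have "0 < real L" by (simp add: L_def)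
  \<comment> \<open>The conditions ensure, in order, k \<le> \<delta> (n-1-(J+1)) for the Stirling
    estimates, kL + 2 \<le> n for the construction of \<pi>, and J+1 < n-1.\<close>
  have "\<forall>\<^sub>F n in sequentially. real n powr \<alpha> \<le> \<delta> * real n - \<delta> * (J + 2) \<and>
      real n powr \<alpha> \<le> 1 / L * real n - 2 / L \<and> n \<ge> J + 3"
    using assms(4) \<delta>(1) \<open>0 < real L\<close>
    by (intro eventually_conj eventually_powr_le_linear eventually_ge_at_top) auto
  then obtain N where N: "\<And>n. n \<ge> N \<Longrightarrow> real n powr \<alpha> \<le> \<delta> * real n - \<delta> * (J + 2) \<and>
      real n powr \<alpha> \<le> 1 / L * real n - 2 / L \<and> n \<ge> J + 3"
    unfolding eventually_sequentially by blast
  show ?thesis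
  proof (intro exI[of _ N] allI impI ballI)
    fix n k r s :: nat
    assume n: "N \<le> n" and k: "1 \<le> k \<and> real k \<le> real n powr \<alpha>"
      and rs: "r \<in> {1..n}" "s \<in> {1..n}" "k = 1 \<longrightarrow> r \<noteq> s"
    note N = N[OF n]
    have "real k \<le> (real n - 2) / L" using k N by (simp add: diff_divide_distrib)
    then have "real (k * L + 2) \<le> real n" using \<open>0 < real L\<close> by (simp add: field_simps)
    then have kL: "k * (2 * Suc J + 3) + 2 \<le> n" unfolding L_def by (simp only: of_nat_le_iff)
    obtain \<pi> where \<pi>: "\<pi> \<in> Sym n k" "admissible_triple n k r s \<pi>"
      and cnt: "\<And>I. I \<subseteq> {i \<in> {1..n}. i \<noteq> r \<and> \<pi> i \<noteq> s} \<Longrightarrow> card I \<le> Suc J \<Longrightarrow>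
        card {\<tau> \<in> Sym n k. \<tau> r = s \<and> (\<forall>i\<in>I. \<tau> i = \<pi> i)} =
          stirling (n - 1 - card I) (k - of_bool (r = s))"
      using exists_admissible_with_exact_counts[OF _ kL rs(1,2)] k rs(3) by blast
    \<comment> \<open>For \<open>k = 1\<close> the hypothesis r \<noteq> s prevents a zero cycle
      count, and the Stirling estimates are phrased for \<open>Suc l\<close>.\<close>
    have "k - of_bool (r = s) \<noteq> 0" using k rs(3) by (cases "r = s") auto
    then obtain l where l: "k - of_bool (r = s) = Suc l" using not0_implies_Suc by blast
    have p: "\<pi> permutes {1..n}" "\<pi> r \<noteq> s" using \<pi> by (auto simp: Sym_def admissible_triple_def)
    have "Suc l \<le> k" using l by linarith
    then have "real (Suc l) \<le> \<delta> * real n - \<delta> * (J + 2)" using k N by linarith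
    also have "\<dots> = \<delta> * real (n - 1 - Suc J)" using N by (simp add: of_nat_diff algebra_simps)
    finally have large: "real (Suc l) \<le> \<delta> * real (n - 1 - Suc J)" .
    also have "\<dots> \<le> \<delta> * real (n - 1 - J)" using \<delta>(1) by (intro mult_left_mono) auto
    finally have large': "real (Suc l) \<le> \<delta> * real (n - 1 - J)" .
    \<comment> \<open>The same \<pi> serves both bounds: its counts hold up to \<open>Suc J\<close>
      agreements, so they can be truncated at the even \<open>J\<close> and at the odd
      \<open>Suc J\<close>.\<close>
    have "(1 - 1 / exp 1 - \<xi>) * real (stirling (n - 1) (Suc l)) \<le> real (card (Sym_meeting n k r s \<pi>))"
      by (rule card_Sym_meeting_approx(1)[OF p(1) rs(1,2) p(2) cnt[unfolded l, OF _ le_SucI] _ _ large' err J(1)])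
        (use N \<delta>(1) in auto)
    moreover have "real (card (Sym_meeting n k r s \<pi>)) \<le> (1 - 1 / exp 1 + \<xi>) * real (stirling (n - 1) (Suc l))"
      by (rule card_Sym_meeting_approx(2)[OF p(1) rs(1,2) p(2) cnt[unfolded l] _ _ large err'])
        (use N \<delta>(1) J(1) in auto)
    ultimately show "\<exists>\<pi>\<in>Sym n k. admissible_triple n k r s \<pi> \<and>
        (1 - 1 / exp 1 - \<xi>) * real (stirling (n - 1) (k - of_bool (r = s)))
          \<le> real (card (Sym_meeting n k r s \<pi>)) \<and>
        real (card (Sym_meeting n k r s \<pi>))
          \<le> (1 - 1 / exp 1 + \<xi>) * real (stirling (n - 1) (k - of_bool (r = s)))"
      unfolding l using \<pi> by blast
  qed
qed

end
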